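(* $\alpha(13,2)=3781$. More precisely, there exists an independent set of cardinality $3781$ in the simple graph underlying $B(13,2)$ that contains the word $0^{13}$ and does not contain the word $1^{13}$.
   Context: The de Bruijn digraph $B(k,2)$ has vertex set $\{0,1\}^k$ and edges $x_1\dots x_k\to x_2\dots x_k y$, $y\in\{0,1\}$. In its underlying simple graph (loops deleted), distinct words $x_1\dots x_k$, $y_1\dots y_k$ are adjacent iff $x_2\dots x_k=y_1\dots y_{k-1}$ or $y_2\dots y_k=x_1\dots x_{k-1}$. $\alpha(k,2)$ is the independence number of this simple graph. *)

theory Defs
  imports "Graph_Theory.Digraph_Component"
begin

definition words :: "nat \<Rightarrow> nat \<Rightarrow> nat list set" where
  "words k d = {w. length w = k \<and> set w \<subseteq> {..<d}}"

text \<open>Arguments are in the order word length, alphabet size. The definition is meant for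
  \<open>k \<ge> 1\<close>; the arcs include the loops at the constant words.\<close>

definition de_bruijn :: "nat \<Rightarrow> nat \<Rightarrow> nat list pair_pre_digraph" where
  "de_bruijn k d =
    \<lparr> pverts = words k d, parcs = {(x, tl x @ [y]) | x y. x \<in> words k d \<and> y < d} \<rparr>"

text \<open>A simple graph is represented, as in the library, by a pair digraph with a symmetric and
  irreflexive arc relation.\<close>

definition underlying_simple_graph :: "'a pair_pre_digraph \<Rightarrow> 'a pair_pre_digraph" where
  "underlying_simple_graph G =
    \<lparr> pverts = pverts G, parcs = parcs (mk_symmetric (with_proj G)) - Id \<rparr>"

definition independent_set :: "'a pair_pre_digraph \<Rightarrow> 'a set \<Rightarrow> bool" where
  "independent_set G S \<longleftrightarrow>
    S \<subseteq> pverts G \<and> (\<forall>u\<in>S. \<forall>v\<in>S. (u, v) \<notin> parcs G)"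

text \<open>Only meaningful for graphs with finitely many vertices, where the set below is finite and
  contains \<open>0\<close>.\<close>

definition independence_number :: "'a pair_pre_digraph \<Rightarrow> nat" where
  "independence_number G = Max {card S | S. independent_set G S}"

definition de_bruijn_alpha :: "nat \<Rightarrow> nat \<Rightarrow> nat" where
  "de_bruijn_alpha k d = independence_number (underlying_simple_graph (de_bruijn k d))"

lemma finite_words: "finite (words k d)"
  using finite_lists_length_eq[of "{..<d}" k] by (simp add: words_def conj_commute)

lemma arc_underlying_de_bruijn_iff:
  assumes "k \<ge> 1"
  shows "(x, y) \<in> parcs (underlying_simple_graph (de_bruijn k d)) \<longleftrightarrow>
    x \<in> words k d \<and> y \<in> words k d \<and> x \<noteq> y \<and> (tl x = butlast y \<or> tl y = butlast x)"
proof -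
  have arc: "(u, v) \<in> parcs (de_bruijn k d) \<longleftrightarrow>
      u \<in> words k d \<and> v \<in> words k d \<and> tl u = butlast v" for u v
  proof
    assume "(u, v) \<in> parcs (de_bruijn k d)"
    then obtain b where "u \<in> words k d" "b < d" "v = tl u @ [b]"
      by (auto simp: de_bruijn_def)
    then show "u \<in> words k d \<and> v \<in> words k d \<and> tl u = butlast v"
      using assms by (cases u) (auto simp: words_def)
  next
    assume h: "u \<in> words k d \<and> v \<in> words k d \<and> tl u = butlast v"
    then have "v \<noteq> []" using assms by (auto simp: words_def)
    then have "v = tl u @ [last v]" "last v \<in> set v"
      using h by simp_all
    moreover have "last v < d"
      using h \<open>last v \<in> set v\<close> by (auto simp: words_def)
    ultimately show "(u, v) \<in> parcs (de_bruijn k d)"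
      using h unfolding de_bruijn_def by simp blast
  qed
  have usg: "(x, y) \<in> parcs (underlying_simple_graph (de_bruijn k d)) \<longleftrightarrow>
      x \<noteq> y \<and> ((x, y) \<in> parcs (de_bruijn k d) \<or> (y, x) \<in> parcs (de_bruijn k d))"
    unfolding underlying_simple_graph_def parcs_mk_symmetric
    by simp (metis fst_conv prod.exhaust_sel snd_conv)
  show ?thesis unfolding usg arc by blast
qed

end

(* Upper bound for odd word length k = 2h + 1: the rotations of a nonconstant word form a closed
   walk of length k without loops, so an independent set meets at most h of them. If it contains
   both constant words and always meets exactly h, then starting from b^k it is forced, by
   induction on n, to omit (ab)^n a b^(2h-2n) and its reversal, hence to contain their shifts that
   begin or end with b. For (a, b) = (1, 0) this puts (01)^h 0 in the set, and for (a, b) = (0, 1)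
   it excludes that word.

   Lower bound: for any function F on words of length k - 1, the words x with F > 0 on the first
   k - 1 letters and F <= 0 on the last k - 1 letters are independent. Take F linear. With weights
   (-1)^i sin (pi i / k), i = 1, ..., k - 1, the values of F along the rotations of x are, up to
   alternating signs, equally spaced samples of half a period of a sine, so they change from
   positive to nonpositive exactly h times unless that sine vanishes. The weights used below are
   29 sin (pi i / 13), rounded. *)
theory Submission
  imports Defs
begin

section \<open>Words, adjacency and rotations\<close>

lemma independent_set_underlying_de_bruijn_iff:
  assumes "k \<ge> 1"
  shows "independent_set (underlying_simple_graph (de_bruijn k d)) S \<longleftrightarrow>
    S \<subseteq> words k d \<and> (\<forall>x\<in>S. \<forall>y\<in>S. tl x = butlast y \<longrightarrow> x = y)"
proof -
  have "pverts (underlying_simple_graph (de_bruijn k d)) = words k d"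
    by (simp add: underlying_simple_graph_def de_bruijn_def)
  then show ?thesis
    \<comment> \<open>Ranging over ordered pairs covers both directions of adjacency; the conclusion
      \<open>x = y\<close> allows for the deleted loops.\<close>
    unfolding independent_set_def arc_underlying_de_bruijn_iff[OF assms] by blast
qed

lemma card_words: "card (words k d) = d ^ k"
  using card_lists_length_eq[of "{..<d}" k] by (simp add: words_def conj_commute)

lemma rotate_mem_words_iff [simp]: "rotate n x \<in> words k d \<longleftrightarrow> x \<in> words k d"
  by (simp add: words_def)

lemma rotate_eq_replicate_iff [simp]: "rotate n x = replicate k a \<longleftrightarrow> x = replicate k a"
proof -
  have "(length x = k \<and> set x \<subseteq> {a}) = (x = replicate k a)" for x
    by (auto simp: replicate_eqI) (metis replicate_eqI singletonD subsetD)
  from this[of x] this[of "rotate n x"] show ?thesis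
    by simp
qed

lemma tl_eq_butlast_rotate1: "tl x = butlast (rotate1 x)"
  by (cases x) auto

lemma rotate1_eq_imp_replicate:
  assumes "rotate1 x = x" "x \<noteq> []"
  shows "x = replicate (length x) (hd x)"
proof -
  have "rotate n x = x" for n
    by (induction n) (simp_all add: assms)
  then have "x ! n = hd x" if "n < length x" for n
    using hd_rotate_conv_nth[OF assms(2), of n] that by simp
  then show ?thesis
    by (auto intro: nth_equalityI)
qed

lemma butlast_replicate: "butlast (replicate n a) = replicate (n - 1) a"
  by (cases n) (simp_all add: replicate_append_same[symmetric])

section \<open>The upper bound\<close>

definition nonconstant_words :: "nat \<Rightarrow> nat list set" where
  "nonconstant_words k = words k 2 - {replicate k 0, replicate k 1}"

lemma finite_nonconstant_words: "finite (nonconstant_words k)"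
  by (simp add: nonconstant_words_def finite_words)

lemma constant_mem_words: "a < d \<Longrightarrow> replicate k a \<in> words k d"
  by (auto simp: words_def)

lemma card_nonconstant_words:
  assumes "k \<ge> 1"
  shows "card (nonconstant_words k) = 2 ^ k - 2"
proof -
  have "replicate k 0 \<noteq> replicate k (1::nat)"
    using assms by (simp add: replicate_eq_replicate)
  then have "card {replicate k 0, replicate k (1::nat)} = 2"
    by simp
  then show ?thesis
    unfolding nonconstant_words_def
    by (subst card_Diff_subset) (auto simp: card_words constant_mem_words)
qed

lemma rotate_mem_nonconstant_words_iff [simp]:
  "rotate n x \<in> nonconstant_words k \<longleftrightarrow> x \<in> nonconstant_words k"
  by (simp add: nonconstant_words_def)

lemma rotate1_neq_if_nonconstant:
  assumes "x \<in> nonconstant_words k" "k \<ge> 1"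
  shows "rotate1 x \<noteq> x"
proof
  assume eq: "rotate1 x = x"
  have len: "length x = k" "set x \<subseteq> {..<2}"
    using assms(1) by (auto simp: nonconstant_words_def words_def)
  then have "x \<noteq> []" using assms(2) by auto
  then have "hd x < 2" using len(2) hd_in_set by blast
  then have "hd x = 0 \<or> hd x = 1" by auto
  then show False
    using rotate1_eq_imp_replicate[OF eq \<open>x \<noteq> []\<close>] assms(1) len(1)
    by (auto simp: nonconstant_words_def)
qed

lemma nonconstant_words_length: "x \<in> nonconstant_words k \<Longrightarrow> length x = k"
  by (simp add: nonconstant_words_def words_def)

text \<open>The total rotation is a multiple of the length. The subtraction does not truncate for
  nonempty \<open>x\<close>, even when \<open>n\<close> exceeds the length.\<close>

lemma rotate_inverse: "rotate (length x * n - n) (rotate n x) = x"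
proof (cases "x = []")
  case False
  then have "n \<le> length x * n" by (cases x) auto
  then show ?thesis
    by (simp add: rotate_rotate)
qed simp

lemma bij_betw_rotate_nonconstant_words:
  "bij_betw (rotate n) (nonconstant_words k) (nonconstant_words k)"
proof -
  have "inj_on (rotate n) (nonconstant_words k)"
    by (rule inj_onI) (metis rotate_inverse nonconstant_words_length)
  moreover have "rotate n ` nonconstant_words k \<subseteq> nonconstant_words k"
    by auto
  ultimately show ?thesis
    using endo_inj_surj[OF finite_nonconstant_words] by (auto simp: bij_betw_def)
qed

section \<open>Sequences without adjacent ones on an odd cycle\<close>

lemma sum_lessThan_add:
  fixes f :: "nat \<Rightarrow> nat"
  shows "(\<Sum>i<m + n. f i) = (\<Sum>i<m. f i) + (\<Sum>i<n. f (m + i))"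
  by (induction n) auto

lemma sum_pairs_le:
  fixes f :: "nat \<Rightarrow> nat"
  assumes "\<And>i. f i + f (Suc i) \<le> 1"
  shows "(\<Sum>i<2 * n. f (a + i)) \<le> n"
proof (induction n)
  case (Suc n)
  then show ?case using assms[of "a + 2 * n"] by simp
qed simp

text \<open>Each entry lies in two of the 2h + 1 cyclic pairs, so twice the sum is at most 2h + 1;
  parity removes the last unit.\<close>

lemma sum_odd_cycle_le:
  fixes f :: "nat \<Rightarrow> nat"
  assumes "\<And>i. f i + f (Suc i) \<le> 1" "f (2 * h + 1) = f 0"
  shows "(\<Sum>i<2 * h + 1. f i) \<le> h"
proof -
  have "2 * (\<Sum>i<2 * h + 1. f i) = (\<Sum>i<2 * h + 1. f i) + (\<Sum>i<2 * h + 1. f (Suc i))"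
    using sum.lessThan_Suc_shift[of f "2 * h + 1"] assms(2) by simp
  also have "\<dots> = (\<Sum>i<2 * h + 1. f i + f (Suc i))"
    by (simp only: sum.distrib)
  also have "\<dots> \<le> (\<Sum>i<2 * h + 1. 1)"
    using assms(1) by (rule sum_mono)
  finally show ?thesis by simp
qed

text \<open>In the tight case each even-length run of positions between the zeros contributes at most
  half of its length, which forces the value at either end of the odd-length run to be 1.\<close>

lemma sum_odd_cycle_tight:
  fixes f :: "nat \<Rightarrow> nat"
  assumes pair: "\<And>i. f i + f (Suc i) \<le> 1"
    and tight: "(\<Sum>i<2 * h + 1. f i) = h"
    and zero: "f 0 = 0" "f (2 * n + 1) = 0" and "n < h"
  shows "f (2 * n + 2) = 1" "f (2 * h) = 1"
proof -
  \<comment> \<open>The run from 2n + 2 to 2h has length 2r + 1. The earlier entries give at most n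
    and any 2r consecutive ones at most r, so the end entry split off must supply the missing
    1.\<close>
  obtain r where h: "h = n + 1 + r"
    using \<open>n < h\<close> by (metis add.commute less_iff_Suc_add plus_1_eq_Suc add.assoc)
  have start: "(\<Sum>i<2 * n + 2. f i) \<le> n"
  proof -
    have "(\<Sum>i<2 * n + 2. f i) = (\<Sum>i<1 + 2 * n. f i)"
      using zero(2) by (simp add: add.commute)
    also have "\<dots> = (\<Sum>i<2 * n. f (1 + i))"
      unfolding sum_lessThan_add using zero(1) by simp
    finally show ?thesis using sum_pairs_le[of f 1 n, OF pair] by simp
  qed
  have tight': "(\<Sum>i<(2 * n + 2) + (2 * r + 1). f i) = h"
    using tight h by (simp add: algebra_simps)
  have "(\<Sum>i<2 * r + 1. f (2 * n + 2 + i)) = f (2 * n + 2) + (\<Sum>i<2 * r. f (2 * n + 3 + i))"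
    using sum_lessThan_add[of "\<lambda>i. f (2 * n + 2 + i)" 1 "2 * r"] by (simp add: numeral_3_eq_3)
  then have "f (2 * n + 2) \<ge> 1"
    using tight' start sum_pairs_le[of f "2 * n + 3" r, OF pair] h unfolding sum_lessThan_add
    by linarith
  then show "f (2 * n + 2) = 1" using pair[of "2 * n + 2"] by simp
  have "(\<Sum>i<2 * r + 1. f (2 * n + 2 + i)) = (\<Sum>i<2 * r. f (2 * n + 2 + i)) + f (2 * h)"
    using h by (simp add: algebra_simps)
  then have "f (2 * h) \<ge> 1"
    using tight' start sum_pairs_le[of f "2 * n + 2" r, OF pair] h unfolding sum_lessThan_add
    by linarith
  then show "f (2 * h) = 1" using pair[of "2 * h"] by simp
qed

section \<open>Alternating words (ab)^n a\<close>

fun alternating :: "'a \<Rightarrow> 'a \<Rightarrow> nat \<Rightarrow> 'a list" where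
  "alternating a b 0 = [a]"
| "alternating a b (Suc n) = a # b # alternating a b n"

lemma length_alternating [simp]: "length (alternating a b n) = 2 * n + 1"
  by (induction n) auto

lemma set_alternating_subset: "set (alternating a b n) \<subseteq> {a, b}"
  by (induction n) auto

lemma alternating_Suc_right: "alternating a b (Suc n) = alternating a b n @ [b, a]"
  by (induction n) auto

lemma Cons_alternating_swap: "a # alternating b a n = alternating a b n @ [b]"
  by (induction n) auto

lemma alternating_Suc_swap: "alternating b a (Suc n) = b # alternating a b n @ [b]"
  using Cons_alternating_swap[of a b n] by simp

section \<open>How often an independent set meets the rotations of a word\<close>

locale independent_de_bruijn =
  fixes h :: nat and S :: "nat list set"
  assumes h_pos: "h \<ge> 1"
    and subset_words: "S \<subseteq> words (2 * h + 1) 2"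
    and indep: "\<And>x y. x \<in> S \<Longrightarrow> y \<in> S \<Longrightarrow> tl x = butlast y \<Longrightarrow> x = y"
begin

text \<open>Indexing by the rotation amount counts periodic words with multiplicity, so orbit sizes
  never enter.\<close>

definition visits :: "nat list \<Rightarrow> nat \<Rightarrow> nat" where
  "visits x i = of_bool (rotate i x \<in> S)"

lemma visits_pair:
  assumes "x \<in> nonconstant_words (2 * h + 1)"
  shows "visits x i + visits x (Suc i) \<le> 1"
proof -
  have "rotate1 (rotate i x) \<noteq> rotate i x"
    using assms by (intro rotate1_neq_if_nonconstant[where k = "2 * h + 1"]) auto
  then have "\<not> (rotate i x \<in> S \<and> rotate (Suc i) x \<in> S)"
    using indep[of "rotate i x" "rotate1 (rotate i x)"] tl_eq_butlast_rotate1
    by auto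
  then show ?thesis by (auto simp: visits_def)
qed

lemma sum_visits_le:
  assumes "x \<in> nonconstant_words (2 * h + 1)"
  shows "(\<Sum>i<2 * h + 1. visits x i) \<le> h"
proof (rule sum_odd_cycle_le)
  have "length x = 2 * h + 1"
    using assms by (simp add: nonconstant_words_def words_def)
  then have "rotate (2 * h + 1) x = x"
    by (intro rotate_id) simp
  then show "visits x (2 * h + 1) = visits x 0"
    by (simp only: visits_def rotate0 id_apply)
qed (rule visits_pair[OF assms])

text \<open>Swap the sums: each rotation permutes the nonconstant words, so every \<open>i\<close>
  contributes the same amount.\<close>

lemma sum_sum_visits:
  "(\<Sum>x\<in>nonconstant_words (2 * h + 1). \<Sum>i<2 * h + 1. visits x i) =
    (2 * h + 1) * card (S \<inter> nonconstant_words (2 * h + 1))"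
proof -
  let ?N = "nonconstant_words (2 * h + 1)"
  have "(\<Sum>x\<in>?N. visits x i) = card (S \<inter> ?N)" for i
  proof -
    have "(\<Sum>x\<in>?N. visits x i) = (\<Sum>x\<in>?N. of_bool (x \<in> S))"
      unfolding visits_def by (rule sum.reindex_bij_betw[OF bij_betw_rotate_nonconstant_words])
    also have "\<dots> = card (S \<inter> ?N)"
      using finite_nonconstant_words by (simp add: Int_commute Collect_conj_eq)
    finally show ?thesis .
  qed
  then have "(\<Sum>i<2 * h + 1. \<Sum>x\<in>?N. visits x i) = (2 * h + 1) * card (S \<inter> ?N)"
    by simp
  then show ?thesis by (subst sum.swap)
qed

lemma card_nonconstant_le:
  "(2 * h + 1) * card (S \<inter> nonconstant_words (2 * h + 1)) \<le> h * (2 ^ (2 * h + 1) - 2)"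
  using sum_bounded_above[of "nonconstant_words (2 * h + 1)"
      "\<lambda>x. \<Sum>i<2 * h + 1. visits x i" h] sum_visits_le
  unfolding sum_sum_visits by (simp add: card_nonconstant_words mult.commute)

text \<open>The four words are rotations of (ab)^n a b^(2h-2n) by 0, 2n + 1, 2n + 2 and 2h, so the
  tight case of the odd cycle applies.\<close>

lemma alternating_next_mem:
  assumes ab: "a < 2" "b < 2" "a \<noteq> b"
    and tight: "\<And>x. x \<in> nonconstant_words (2 * h + 1) \<Longrightarrow> (\<Sum>i<2 * h + 1. visits x i) = h"
    and out: "alternating a b n @ replicate (2 * (h - n)) b \<notin> S"
      "replicate (2 * (h - n)) b @ alternating a b n \<notin> S"
    and "n < h"
  shows "replicate (2 * (h - n) - 1) b @ alternating a b n @ [b] \<in> S"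
    and "b # alternating a b n @ replicate (2 * (h - n) - 1) b \<in> S"
proof -
  define u where "u = alternating a b n @ replicate (2 * (h - n)) b"
  obtain r where r: "2 * (h - n) = Suc r"
    using \<open>n < h\<close> by (metis Suc_diff_Suc mult_Suc_right add_Suc numeral_2_eq_2)
  \<comment> \<open>Two groupings of \<open>u\<close>, cut where \<open>rotate_append\<close> is to
    split it.\<close>
  have u: "u = (alternating a b n @ [b]) @ replicate r b"
    "u = (alternating a b n @ replicate r b) @ [b]"
    by (simp_all add: u_def r replicate_append_same)
  have len: "length u = 2 * h + 1"
    using \<open>n < h\<close> by (simp add: u_def)
  have len': "length (alternating a b n @ replicate r b) = 2 * h"
    using r \<open>n < h\<close> by simp
  have "set u \<subseteq> {a, b}"
    using set_alternating_subset[of a b n] by (auto simp: u_def)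
  then have "u \<in> words (2 * h + 1) 2"
    using ab len by (auto simp: words_def)
  moreover have "a \<in> set u" "b \<in> set u"
    by (cases n; simp add: u_def) (simp add: u)
  then have "u \<noteq> replicate (2 * h + 1) c" for c
    using ab(3) by (metis in_set_replicate)
  ultimately have non: "u \<in> nonconstant_words (2 * h + 1)"
    by (simp add: nonconstant_words_def)
  have rot: "rotate (2 * n + 1) u = replicate (2 * (h - n)) b @ alternating a b n"
    "rotate (2 * n + 2) u = replicate r b @ alternating a b n @ [b]"
    "rotate (2 * h) u = b # alternating a b n @ replicate r b"
    subgoal using rotate_append[of "alternating a b n"] by (simp add: u_def)
    subgoal using rotate_append[of "alternating a b n @ [b]" "replicate r b"] by (simp add: u(1))
    subgoal using rotate_append[of "alternating a b n @ replicate r b" "[b]"]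
      unfolding u(2) len' by simp
    done
  have "visits u 0 = 0" "visits u (2 * n + 1) = 0"
    using out unfolding visits_def rot by (simp_all add: u_def)
  from sum_odd_cycle_tight[OF visits_pair[OF non] tight[OF non] this \<open>n < h\<close>]
  have "rotate (2 * n + 2) u \<in> S" "rotate (2 * h) u \<in> S"
    by (simp_all only: visits_def of_bool_eq_1_iff)
  then show "replicate (2 * (h - n) - 1) b @ alternating a b n @ [b] \<in> S"
    and "b # alternating a b n @ replicate (2 * (h - n) - 1) b \<in> S"
    by (simp_all only: rot r diff_Suc_1)
qed

lemma alternating_not_mem:
  assumes ab: "a < 2" "b < 2" "a \<noteq> b"
    and const: "replicate (2 * h + 1) b \<in> S"
    and tight: "\<And>x. x \<in> nonconstant_words (2 * h + 1) \<Longrightarrow> (\<Sum>i<2 * h + 1. visits x i) = h"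
    and "n \<le> h"
  shows "alternating a b n @ replicate (2 * (h - n)) b \<notin> S \<and>
    replicate (2 * (h - n)) b @ alternating a b n \<notin> S"
  using \<open>n \<le> h\<close>
proof (induction n)
  case 0
  \<comment> \<open>Both words of the base case are neighbours of the constant word of
    \<open>b\<close>.\<close>
  have "a # replicate (2 * h) b \<notin> S"
    using indep[OF _ const, of "a # replicate (2 * h) b"] ab(3)
    unfolding butlast_replicate by auto
  moreover have "replicate (2 * h + 1) b \<noteq> replicate (2 * h) b @ [a]"
    using ab(3) by (metis in_set_conv_decomp in_set_replicate)
  then have "replicate (2 * h) b @ [a] \<notin> S"
    using indep[OF const, of "replicate (2 * h) b @ [a]"]
    by auto
  ultimately show ?case by simp
next
  case (Suc n)
  then have out: "alternating a b n @ replicate (2 * (h - n)) b \<notin> S"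
      "replicate (2 * (h - n)) b @ alternating a b n \<notin> S" and "n < h"
    by auto
  from alternating_next_mem[OF ab tight out \<open>n < h\<close>]
  have mem: "replicate (2 * (h - n) - 1) b @ alternating a b n @ [b] \<in> S"
    "b # alternating a b n @ replicate (2 * (h - n) - 1) b \<in> S"
    by auto
  obtain r where r: "h - n = Suc r" "h - Suc n = r"
    using \<open>n < h\<close> by (metis Suc_diff_Suc)
  \<comment> \<open>Without its first letter this is the word of \<open>mem(2)\<close> without its
    last; the first letters a and b differ. The next claim is the mirror image, using
    \<open>mem(1)\<close>.\<close>
  have "a # b # alternating a b n @ replicate (2 * r) b \<notin> S"
    using indep[OF _ mem(2), of "a # b # alternating a b n @ replicate (2 * r) b"] ab(3) r
    by (auto simp: butlast_append replicate_append_same[symmetric])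
  moreover have "replicate (2 * r) b @ alternating a b n @ [b, a] \<notin> S"
    using indep[OF mem(1), of "replicate (2 * r) b @ alternating a b n @ [b, a]"] ab(3) r
    by (auto simp: butlast_append)
  ultimately show ?case
    unfolding r(2) by (metis alternating.simps(2) alternating_Suc_right append_Cons)
qed

lemma card_nonconstant_less:
  assumes const: "replicate (2 * h + 1) 0 \<in> S" "replicate (2 * h + 1) 1 \<in> S"
  shows "(2 * h + 1) * card (S \<inter> nonconstant_words (2 * h + 1)) < h * (2 ^ (2 * h + 1) - 2)"
proof (rule ccontr)
  let ?N = "nonconstant_words (2 * h + 1)"
  assume "\<not> ?thesis"
  then have ge: "h * card ?N \<le> (\<Sum>x\<in>?N. \<Sum>i<2 * h + 1. visits x i)"
    unfolding sum_sum_visits by (simp add: card_nonconstant_words)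
  \<comment> \<open>The average over nonconstant words attains the individual bound h, so every term
    does.\<close>
  have tight: "(\<Sum>i<2 * h + 1. visits x i) = h" if "x \<in> ?N" for x
  proof (rule ccontr)
    assume "(\<Sum>i<2 * h + 1. visits x i) \<noteq> h"
    then have "(\<Sum>i<2 * h + 1. visits x i) < h"
      using sum_visits_le[OF that] by simp
    then have "(\<Sum>x\<in>?N. \<Sum>i<2 * h + 1. visits x i) < (\<Sum>x\<in>?N. h)"
      using sum_visits_le that by (intro sum_strict_mono_ex1 finite_nonconstant_words) blast+
    then show False using ge by (simp add: mult.commute)
  qed
  obtain n where n: "h = Suc n" using h_pos by (cases h) auto
  \<comment> \<open>Here h - n = 1, so the padding is a single 0 and the word is (01)^h 0, excluded
    below with the letters exchanged.\<close>
  have "0 # alternating 1 0 n @ [0] \<in> S"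
    using alternating_next_mem(2)[of 1 0 n] alternating_not_mem[OF _ _ _ const(1), of 1 n] tight n
    by simp
  moreover have "alternating 0 1 (Suc n) \<notin> S"
    using alternating_not_mem[OF _ _ _ const(2), of 0 h] tight n by simp
  ultimately show False by (simp only: alternating_Suc_swap) simp
qed

end

text \<open>Strictness has two sources: with both constant words in \<open>S\<close> the rotation
  bound itself is strict; otherwise at most one constant word is added, and subtracting 2 leaves one
  to spare.\<close>

lemma card_independent_set_le:
  assumes h: "h \<ge> 1"
    and S: "independent_set (underlying_simple_graph (de_bruijn (2 * h + 1) 2)) S"
  shows "(2 * h + 1) * (card S - 2) < h * (2 ^ (2 * h + 1) - 2)"
proof -
  interpret independent_de_bruijn h S
    using assms by unfold_locales (auto simp: independent_set_underlying_de_bruijn_iff)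
  let ?N = "S \<inter> nonconstant_words (2 * h + 1)"
  let ?C = "{replicate (2 * h + 1) 0, replicate (2 * h + 1) (1::nat)}"
  have "S = ?N \<union> (S \<inter> ?C)"
    using subset_words by (auto simp: nonconstant_words_def)
  then have card: "card S \<le> card ?N + card (S \<inter> ?C)"
    by (metis card_Un_le)
  show ?thesis
  proof (cases "?C \<subseteq> S")
    case True
    have "card (S \<inter> ?C) \<le> card ?C"
      by (rule card_mono) auto
    also have "\<dots> \<le> 2"
      by (simp add: card_insert_if)
    finally have "card S - 2 \<le> card ?N" using card by simp
    then show ?thesis
      using card_nonconstant_less True by (meson insert_subset le_less_trans mult_le_mono2)
  next
    case False
    then obtain c where "S \<inter> ?C \<subseteq> {c}" by blast
    then have "card (S \<inter> ?C) \<le> 1"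
      using card_mono[of "{c}" "S \<inter> ?C"] by simp
    then have "card S - 1 \<le> card ?N" using card by simp
    then have le: "(2 * h + 1) * (card S - 1) \<le> h * (2 ^ (2 * h + 1) - 2)"
      using card_nonconstant_le by (meson le_trans mult_le_mono2)
    show ?thesis
    \<comment> \<open>For small \<open>S\<close> truncated subtraction could make both differences
      0.\<close>
    proof (cases "card S \<le> 2")
      case True
      have "(2::nat) ^ 1 < 2 ^ (2 * h + 1)"
        using h by (intro power_strict_increasing) auto
      then show ?thesis using True h by simp
    next
      case False
      then have "(2 * h + 1) * (card S - 2) < (2 * h + 1) * (card S - 1)"
        by (intro mult_strict_left_mono) auto
      from this le show ?thesis by (rule less_le_trans)
    qed
  qed
qed

section \<open>The lower bound\<close>

text \<open>Surplus letters count as 0, so twelve weights read the first twelve letters of a word of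
  length 13, and the last twelve when applied to its tail.\<close>

fun weight :: "int list \<Rightarrow> nat list \<Rightarrow> int" where
  "weight (c # cs) (x # xs) = c * int x + weight cs xs"
| "weight _ _ = 0"

lemma weight_Nil [simp]: "weight cs [] = 0"
  by (cases cs) simp_all

lemma weight_Cons_zero [simp]: "weight (0 # cs) x = weight cs (tl x)"
  by (cases x) simp_all

lemma weight_append_zero [simp]: "weight (cs @ [0]) x = weight cs x"
  by (induction cs x rule: weight.induct) simp_all

lemma weight_butlast: "length cs < length x \<Longrightarrow> weight cs (butlast x) = weight cs x"
  by (induction cs x rule: weight.induct) auto

lemma weight_replicate_zero [simp]: "weight cs (replicate n 0) = 0"
proof (induction n arbitrary: cs)
  case (Suc n)
  then show ?case by (cases cs) auto
qed simp

fun count_signs :: "(int \<times> int) list \<Rightarrow> int \<Rightarrow> int \<Rightarrow> nat" where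
  "count_signs [] a b = (if 0 < a \<and> b \<le> 0 then 1 else 0)"
| "count_signs ((p, q) # r) a b = count_signs r a b + count_signs r (a + p) (b + q)"

lemma card_words_Suc_filter:
  "card {x \<in> words (Suc k) 2. P x} =
    card {x \<in> words k 2. P (0 # x)} + card {x \<in> words k 2. P (1 # x)}"
proof -
  have "{x \<in> words (Suc k) 2. P x} =
      Cons 0 ` {x \<in> words k 2. P (0 # x)} \<union> Cons 1 ` {x \<in> words k 2. P (1 # x)}"
    by (auto simp: words_def length_Suc_conv less_2_cases_iff)
  then show ?thesis
    by (simp only:, subst card_Un_disjoint) (auto simp: finite_words card_image)
qed

text \<open>Branch on the first letter; \<open>a\<close> and \<open>b\<close> carry the partial sums
  of the two linear forms, which makes the count executable.\<close>

lemma card_signs_eq_count_signs: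
  "card {x \<in> words (length r) 2. 0 < a + weight (map fst r) x \<and> b + weight (map snd r) x \<le> 0} =
    count_signs r a b"
proof (induction r a b rule: count_signs.induct)
  case (1 a b)
  have "words 0 2 = {[]}" by (auto simp: words_def)
  then show ?case by (simp add: Collect_conv_if)
next
  case (2 p q r a b)
  then show ?case by (simp add: card_words_Suc_filter add.assoc)
qed

section \<open>An independent set of size 3781\<close>

definition sine_weights :: "int list" where
  "sine_weights = [-7, 13, -19, 24, -27, 29, -29, 27, -24, 19, -13, 7]"

definition large_independent_set :: "nat list set" where
  "large_independent_set = insert (replicate 13 0)
    {x \<in> words 13 2. 0 < weight sine_weights x \<and> weight sine_weights (tl x) \<le> 0}"

lemma card_large_independent_set: "card large_independent_set = 3781"
proof -
  \<comment> \<open>Padding by a zero at opposite ends turns the values on the first and last twelve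
    letters into two forms on all thirteen.\<close>
  define r where "r = zip (sine_weights @ [0]) (0 # sine_weights)"
  have r: "map fst r = sine_weights @ [0]" "map snd r = 0 # sine_weights" "length r = 13"
    by (simp_all add: r_def sine_weights_def)
  have "card {x \<in> words 13 2. 0 < weight sine_weights x \<and> weight sine_weights (tl x) \<le> 0} =
      count_signs r 0 0"
    using card_signs_eq_count_signs[of r 0 0] unfolding r by simp
  also have "\<dots> = 3780"
    unfolding r_def sine_weights_def by code_simp
  \<comment> \<open>The zero word has weight 0, fails the strict inequality and so adds one
    element.\<close>
  finally show ?thesis
    by (simp add: large_independent_set_def finite_words)
qed

lemma independent_large_independent_set:
  "independent_set (underlying_simple_graph (de_bruijn 13 2)) large_independent_set"
proof -
  let ?z = "replicate 13 0 :: nat list"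
  have len: "length sine_weights = 12" by (simp add: sine_weights_def)
  have "x = y" if x: "x \<in> large_independent_set" and y: "y \<in> large_independent_set"
    and adj: "tl x = butlast y" for x y
  proof -
    have "weight sine_weights (tl x) \<le> 0"
      using x by (auto simp: large_independent_set_def)
    moreover have "length y = 13"
      using y by (auto simp: large_independent_set_def words_def)
    ultimately have "weight sine_weights y \<le> 0"
      using weight_butlast[of sine_weights y] adj len by simp
    then have "y = ?z"
      using y by (auto simp: large_independent_set_def)
    then have "tl x = replicate 12 0"
      using adj by (simp add: butlast_replicate)
    moreover obtain a where "x = a # tl x"
      using x by (cases x) (auto simp: large_independent_set_def words_def)
    ultimately have "x = a # replicate 12 0" by simp
    \<comment> \<open>The first weight, -7, is negative; this sign keeps 1 0^12 out of the
      set.\<close>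
    then have "weight sine_weights x \<le> 0"
      by (simp add: sine_weights_def)
    then have "x = ?z"
      using x by (auto simp: large_independent_set_def)
    with \<open>y = ?z\<close> show ?thesis by simp
  qed
  moreover have "large_independent_set \<subseteq> words 13 2"
    using constant_mem_words[of 0 2 13] by (auto simp: large_independent_set_def)
  ultimately show ?thesis
    by (simp add: independent_set_underlying_de_bruijn_iff)
qed

theorem theorem4p9:
  shows "de_bruijn_alpha 13 2 = 3781 \<and>
    (\<exists>S. independent_set (underlying_simple_graph (de_bruijn 13 2)) S \<and> card S = 3781 \<and>
      replicate 13 0 \<in> S \<and> replicate 13 1 \<notin> S)"
proof (intro conjI exI)
  let ?indep = "independent_set (underlying_simple_graph (de_bruijn 13 2))"
  have le: "card S \<le> 3781" if "?indep S" for S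
    \<comment> \<open>For h = 6 the bound reads 13 (card S - 2) < 6 * 8190 = 13 * 3780.\<close>
    using card_independent_set_le[of 6 S] that by simp
  show "de_bruijn_alpha 13 2 = 3781"
    unfolding de_bruijn_alpha_def independence_number_def
  proof (rule Max_eqI)
    have "{card S |S. ?indep S} \<subseteq> {..3781}" using le by auto
    then show "finite {card S |S. ?indep S}"
      using finite_subset by blast
    show "3781 \<in> {card S |S. ?indep S}"
      using card_large_independent_set independent_large_independent_set by force
  qed (use le in auto)
  show "?indep large_independent_set" by (rule independent_large_independent_set)
  show "card large_independent_set = 3781" by (rule card_large_independent_set)
  \<comment> \<open>The weights sum to 0, so the all-ones word fails the strict inequality.\<close>
  show "replicate 13 0 \<in> large_independent_set" "replicate 13 1 \<notin> large_independent_set"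
    by (simp_all add: large_independent_set_def sine_weights_def numeral_eq_Suc)
qed

end
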